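(* Let $\mathbb{F}$ be a field. Let $a(s)=a_0+sa_1,\ b(s)=b_0+sb_1\in \mathbb{F}[s]$ be such that $a(s)\neq 0$ and $b(s)\neq 0$. Let $\phi_1(s,t)$ and $\psi_1(s,t)$ be the homogeneous invariant factors of $a(s)$ and $b(s)$ (viewed as $1\times 1$ matrix pencils), respectively. Let $r$ be an integer, $0\leq r\leq 1$. 1. If $|\mathbb{F}|>2$ or $r=0$, then there exists $p(s)=p_0+sp_1\in \mathbb{F}[s]$ such that $\operatorname{rank}(p(s))=r$ and $a(s)+p(s)$ is strictly equivalent to $b(s)$ if and only if $$\phi_{1-r}(s,t)\mid\psi_1(s,t)\mid\phi_{1+r}(s,t),$$ where $\phi_j(s,t):=1$ for $j<1$ and $\phi_j(s,t):=0$ for $j>1$. 2. If $|\mathbb{F}|=2$ and $r=1$, then there exists $p(s)\in \mathbb{F}[s]$ such that $\operatorname{rank}(p(s))=1$ and $a(s)+p(s)$ is strictly equivalent to $b(s)$ if and only if $a(s)\neq b(s)$.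
   Context: A matrix pencil is a polynomial matrix $G(s)=G_0+sG_1$ of degree at most $1$. $\operatorname{rank}(G(s))$ denotes the normal rank, i.e. the rank of $G(s)$ over the field of fractions of $\mathbb{F}[s]$; a $1\times1$ pencil has rank $1$ if it is nonzero and rank $0$ otherwise. Two pencils $G(s),H(s)\in\mathbb{F}[s]^{m\times n}$ are strictly equivalent if $G(s)=QH(s)R$ for some invertible constant matrices $Q\in\mathrm{GL}_m(\mathbb{F})$, $R\in\mathrm{GL}_n(\mathbb{F})$; for $1\times 1$ pencils this means that they differ by a nonzero factor in $\mathbb{F}$. For a pencil $G(s)=G_0+sG_1$ of normal rank $\rho$, put $G(s,t)=tG_0+sG_1$. For $1\le k\le\rho$, let $\Delta_k(s,t)$ be the greatest common divisor of the $k\times k$ minors of $G(s,t)$, a homogeneous polynomial normalized to be monic with respect to $s$ (the monomial of highest degree in $s$ has coefficient $1$), and $\Delta_0:=1$. The homogeneous invariant factors of $G(s)$ are $\Gamma_k(s,t)=\Delta_k(s,t)/\Delta_{k-1}(s,t)$, $1\le k\le\rho$. *)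

theory Defs
  imports
    "HOL-Computational_Algebra.Polynomial_Factorial"
    "HOL-Library.Cardinality"
    "Jordan_Normal_Form.DL_Rank"
    "Jordan_Normal_Form.DL_Submatrix"
begin

text \<open>
  A matrix pencil G(s) over a field is represented as a matrix over the polynomials in s
  (\<open>'a poly mat\<close>) whose entries have degree at most one. Polynomials in s and t are elements of
  \<open>'a poly poly\<close>: the outer indeterminate is s, the inner one is t.
\<close>

definition normal_rank :: "'a::field poly mat \<Rightarrow> nat" where
  "normal_rank G = vec_space.rank (dim_row G) (map_mat to_fract G)"

definition const_mat :: "'a::field mat \<Rightarrow> 'a poly mat" where
  "const_mat Q = map_mat (\<lambda>c. [:c:]) Q"

definition strictly_equivalent :: "'a::field poly mat \<Rightarrow> 'a poly mat \<Rightarrow> bool" where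
  "strictly_equivalent G H \<longleftrightarrow>
     dim_row G = dim_row H \<and> dim_col G = dim_col H \<and>
     (\<exists>Q \<in> carrier_mat (dim_row H) (dim_row H). \<exists>R \<in> carrier_mat (dim_col H) (dim_col H).
        invertible_mat Q \<and> invertible_mat R \<and> G = const_mat Q * H * const_mat R)"

text \<open>
  For an entry \<open>g0 + s g1\<close> the homogenization is \<open>t g0 + s g1\<close>, whose coefficient
  of \<open>s^0\<close> is \<open>[:0, g0:]\<close> (that is, \<open>g0 t\<close>).
\<close>

definition homogenize_pencil :: "'a::field poly mat \<Rightarrow> 'a poly poly mat" where
  "homogenize_pencil G = map_mat (\<lambda>g. [: [:0, coeff g 0:], [:coeff g 1:] :]) G"

definition minors :: "nat \<Rightarrow> 'b::comm_ring_1 mat \<Rightarrow> 'b set" where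
  "minors k A = {det (submatrix A I J) | I J.
     I \<subseteq> {..<dim_row A} \<and> J \<subseteq> {..<dim_col A} \<and> card I = k \<and> card J = k}"

definition is_gcd_of :: "'b::comm_semiring_1 \<Rightarrow> 'b set \<Rightarrow> bool" where
  "is_gcd_of D M \<longleftrightarrow> (\<forall>m\<in>M. D dvd m) \<and> (\<forall>E. (\<forall>m\<in>M. E dvd m) \<longrightarrow> E dvd D)"

text \<open>
  \<open>lead_coeff\<close> of \<open>D\<close> is the polynomial in t multiplying the highest power of s. For
  homogeneous \<open>D\<close> it is a single monomial in t, and its own leading coefficient is the
  coefficient in \<open>D\<close> of the monomial of highest degree in s.
\<close>

definition monic_in_s :: "'a::field poly poly \<Rightarrow> bool" where
  "monic_in_s D \<longleftrightarrow> lead_coeff (lead_coeff D) = 1"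

text \<open>
  The units of \<open>'a poly poly\<close> are the nonzero constants, so for \<open>1 \<le> k \<le> normal_rank G\<close>
  the gcd (which is nonzero) is made unique by the normalization. The definite description
  avoids restricting \<open>'a\<close> to the fields that carry a library \<open>gcd\<close> instance.
\<close>

definition det_divisor :: "'a::field poly mat \<Rightarrow> nat \<Rightarrow> 'a poly poly" where
  "det_divisor G k =
     (if k = 0 then 1
      else (THE D. is_gcd_of D (minors k (homogenize_pencil G)) \<and> monic_in_s D))"

text \<open>
  The homogeneous invariant factors, extended to all integer indices by 1 below index 1 and by
  0 above the normal rank. The division is exact.
\<close>

definition hom_inv_factor :: "'a::field poly mat \<Rightarrow> int \<Rightarrow> 'a poly poly" where
  "hom_inv_factor G j =
     (if j < 1 then 1
      else if j > int (normal_rank G) then 0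
      else det_divisor G (nat j) div det_divisor G (nat j - 1))"

definition pencil1 :: "'a::field poly \<Rightarrow> 'a poly mat" where
  "pencil1 g = mat 1 1 (\<lambda>_. g)"

end

theory Submission
  imports Defs
begin

text \<open>For 1 by 1 pencils every notion collapses to comparison up to a nonzero scalar. Strict
  equivalence means proportionality (\<open>strictly_equivalent_pencil1\<close>), and the first
  homogeneous invariant factor is the homogenization up to a nonzero constant
  (\<open>hom_inv_factor_pencil1\<close>). Mutual divisibility of the two invariant factors is
  therefore again proportionality (\<open>hom_inv_factor_mutual_dvd_iff\<close>), which settles rank
  0, where p must vanish. For rank 1 the only candidates are p = c b - a with c nonzero, so the
  question is whether some nonzero c has c b different from a. With at least two nonzero scalars
  this always holds, since a cannot equal two distinct multiples of b, and the divisibility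
  condition 1 | psi | 0 always holds too. Over the field with two elements only c = 1 remains, which
  leaves the condition that a and b differ.\<close>

section \<open>Rank and strict equivalence of 1 by 1 pencils\<close>

lemma pencil1_carrier [simp]: "pencil1 g \<in> carrier_mat 1 1"
  by (simp add: pencil1_def)

lemma pencil1_index [simp]: "pencil1 g $$ (0, 0) = g"
  by (simp add: pencil1_def)

text \<open>The rank is at most 1, and it is full exactly when the determinant, which is the image
  of \<open>g\<close> in the fraction field, is nonzero.\<close>

lemma normal_rank_pencil1: "normal_rank (pencil1 g) = (if g = 0 then 0 else 1)"
proof -
  interpret vec_space "TYPE('a poly fract)" 1 .
  let ?A = "map_mat to_fract (pencil1 g)"
  have A: "?A \<in> carrier_mat 1 1" by (simp add: pencil1_def)
  have "det ?A = to_fract g"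
    by (subst det_single[of ?A]) (auto simp: pencil1_def)
  hence "rank ?A = 1 \<longleftrightarrow> g \<noteq> 0"
    using det_rank_iff[OF A] by simp
  moreover have "rank ?A \<le> 1"
    using rank_le_nc[OF A] by simp
  ultimately show ?thesis
    by (auto simp: normal_rank_def pencil1_def)
qed

text \<open>Invertible 1 by 1 matrices are nonzero scalars and commute with everything, so
  \<open>Q\<close> and \<open>R\<close> act only through their product.\<close>

lemma strictly_equivalent_pencil1:
  "strictly_equivalent (pencil1 g) (pencil1 h) \<longleftrightarrow> (\<exists>c. c \<noteq> 0 \<and> g = Polynomial.smult c h)"
proof
  assume "strictly_equivalent (pencil1 g) (pencil1 h)"
  then obtain Q R where Q: "Q \<in> carrier_mat 1 1" and R: "R \<in> carrier_mat 1 1"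
    and inv: "invertible_mat Q" "invertible_mat R"
    and eq: "pencil1 g = const_mat Q * pencil1 h * const_mat R"
    by (auto simp: strictly_equivalent_def pencil1_def)
  have nz: "M $$ (0, 0) \<noteq> 0" if "invertible_mat M" "M \<in> carrier_mat 1 1" for M :: "'a mat"
  proof -
    from that(1) obtain B :: "'a mat" where "M * B = 1\<^sub>m (dim_row M)"
      and BM: "B * M = 1\<^sub>m (dim_row B)"
      unfolding invertible_mat_def inverts_mat_def by blast
    hence MB: "M * B = 1\<^sub>m 1" using that(2) by simp
    \<comment> \<open>\<open>invertible_mat\<close> does not fix the size of the inverse; it is
      recovered by comparing column counts in the two product identities.\<close>
    have "dim_col B = 1" "dim_row B = 1"
      using arg_cong[OF MB, of dim_col] arg_cong[OF BM, of dim_col] that(2) by auto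
    hence B: "B \<in> carrier_mat 1 1" by auto
    have "det M * det B = 1"
      using det_mult[OF that(2) B] MB by simp
    thus ?thesis using det_single[OF that(2)] by auto
  qed
  have "g = (const_mat Q * pencil1 h * const_mat R) $$ (0, 0)"
    by (metis eq pencil1_index)
  also have "\<dots> = Polynomial.smult (Q $$ (0, 0) * R $$ (0, 0)) h"
    using Q R by (auto simp: const_mat_def scalar_prod_def pencil1_def mult.commute)
  finally show "\<exists>c. c \<noteq> 0 \<and> g = Polynomial.smult c h"
    using nz[OF inv(1) Q] nz[OF inv(2) R] by (metis mult_eq_0_iff)
next
  assume "\<exists>c. c \<noteq> 0 \<and> g = Polynomial.smult c h"
  then obtain c where c: "c \<noteq> 0" "g = Polynomial.smult c h" by blast
  let ?M = "\<lambda>d :: 'a. mat 1 1 (\<lambda>_. d)"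
  have inv: "invertible_mat (?M d)" if "d \<noteq> 0" for d
  proof -
    have "inverts_mat (?M d) (?M (inverse d))" "inverts_mat (?M (inverse d)) (?M d)"
      using that by (auto simp: inverts_mat_def scalar_prod_def)
    thus ?thesis by (auto simp: invertible_mat_def)
  qed
  \<comment> \<open>The whole scalar goes into the left factor.\<close>
  have "pencil1 g = const_mat (?M c) * pencil1 h * const_mat (?M 1)"
    by (rule eq_matI) (auto simp: c(2) const_mat_def scalar_prod_def pencil1_def)
  hence "\<exists>Q\<in>carrier_mat 1 1. \<exists>R\<in>carrier_mat 1 1.
      invertible_mat Q \<and> invertible_mat R \<and> pencil1 g = const_mat Q * pencil1 h * const_mat R"
    using inv[OF c(1)] inv[OF one_neq_zero] mat_carrier by blast
  thus "strictly_equivalent (pencil1 g) (pencil1 h)"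
    by (simp add: strictly_equivalent_def pencil1_def)
qed

section \<open>Homogenization and divisibility in two variables\<close>

text \<open>This is the entrywise map of \<open>homogenize_pencil\<close>. It keeps only the
  coefficients up to degree 1, so injectivity below requires degree bounds.\<close>

definition homogenize :: "'a::field poly \<Rightarrow> 'a poly poly" where
  "homogenize g = [: [:0, coeff g 0:], [:coeff g 1:] :]"

lemma homogenize_smult: "homogenize (Polynomial.smult c g) = Polynomial.smult [:c:] (homogenize g)"
  by (simp add: homogenize_def)

lemma homogenize_inject:
  assumes "degree g \<le> 1" "degree h \<le> 1" "homogenize g = homogenize h"
  shows "g = h"
proof (rule poly_eqI)
  fix n
  show "coeff g n = coeff h n"
  proof (cases "n \<le> 1")
    case True
    hence "n = 0 \<or> n = 1" by auto
    thus ?thesis using assms(3) by (auto simp: homogenize_def)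
  next
    case False
    thus ?thesis using assms(1,2) by (simp add: coeff_eq_0)
  qed
qed

lemma is_unit_poly_poly_iff:
  "u dvd 1 \<longleftrightarrow> (\<exists>c. c \<noteq> 0 \<and> u = [:[:c:]:])" for u :: "'a::field poly poly"
  by (metis (full_types) dvd_field_iff is_unit_poly_iff zero_neq_one)

text \<open>Associates in an integral domain differ by a unit, and the units here are the nonzero
  constants. The case \<open>B = 0\<close> is separate because the unit is found by cancelling
  \<open>B\<close>.\<close>

lemma mutual_dvd_poly_poly_iff:
  fixes A B :: "'a::field poly poly"
  shows "A dvd B \<and> B dvd A \<longleftrightarrow> (\<exists>c. c \<noteq> 0 \<and> A = Polynomial.smult [:c:] B)"
proof
  assume AB: "A dvd B \<and> B dvd A"
  show "\<exists>c. c \<noteq> 0 \<and> A = Polynomial.smult [:c:] B"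
  proof (cases "B = 0")
    case True
    thus ?thesis using AB by (auto intro: exI[of _ 1])
  next
    case False
    from AB obtain u v where u: "A = B * u" and v: "B = A * v" by (auto elim!: dvdE)
    have "B * 1 = B * (u * v)" using u v by (metis mult.assoc mult.right_neutral)
    hence "u dvd 1" using False by (metis dvd_triv_left mult_left_cancel)
    thus ?thesis using u by (auto simp: is_unit_poly_poly_iff mult.commute)
  qed
next
  assume "\<exists>c. c \<noteq> 0 \<and> A = Polynomial.smult [:c:] B"
  then obtain c where c: "c \<noteq> 0" "A = Polynomial.smult [:c:] B" by blast
  have "B = Polynomial.smult [:inverse c:] A" using c by (simp add: pCons_one)
  thus "A dvd B \<and> B dvd A" by (metis c(2) dvd_smult dvd_refl)
qed

section \<open>The invariant factor of a 1 by 1 pencil\<close>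

lemma minors_homogenize_pencil1: "minors 1 (homogenize_pencil (pencil1 g)) = {homogenize g}"
proof -
  let ?A = "homogenize_pencil (pencil1 g)"
  have A: "?A \<in> carrier_mat 1 1"
    by (simp add: homogenize_pencil_def pencil1_def)
  hence dims: "dim_row ?A = 1" "dim_col ?A = 1" by auto
  have full: "I \<subseteq> {..<1} \<and> card I = 1 \<longleftrightarrow> I = {0}" for I :: "nat set"
    by (auto simp: card_1_singleton_iff lessThan_Suc)
  \<comment> \<open>This is the cardinality by which \<open>submatrix\<close> computes its
    dimensions.\<close>
  have one: "card {i. i < (1::nat) \<and> i \<in> {0}} = 1"
    by (auto simp: card_1_singleton_iff)
  have "submatrix ?A {0} {0} \<in> carrier_mat 1 1"
    unfolding submatrix_def dims one by simp
  moreover have "submatrix ?A {0} {0} $$ (0, 0) = ?A $$ (0, 0)"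
    unfolding submatrix_def dims one by simp
  ultimately have "det (submatrix ?A {0} {0}) = homogenize g"
    by (simp add: det_single homogenize_pencil_def homogenize_def pencil1_def)
  moreover have "minors 1 ?A = {det (submatrix ?A I J) | I J.
      (I \<subseteq> {..<1} \<and> card I = 1) \<and> (J \<subseteq> {..<1} \<and> card J = 1)}"
    unfolding minors_def dims by (rule Collect_cong) blast
  ultimately show ?thesis unfolding full by simp
qed

text \<open>The greatest common divisors of a single minor are its associates, and
  \<open>monic_in_s\<close> selects exactly one of them, so the definite description is well
  defined. The divisor of index 0 is 1, so the quotient changes nothing.\<close>

lemma hom_inv_factor_pencil1:
  assumes "degree g \<le> 1" "g \<noteq> 0"
  shows "\<exists>c. c \<noteq> 0 \<and> hom_inv_factor (pencil1 g) 1 = Polynomial.smult [:c:] (homogenize g)"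
proof -
  let ?H = "homogenize g"
  let ?l = "lead_coeff (lead_coeff ?H)"
  let ?P = "\<lambda>D. is_gcd_of D (minors 1 (homogenize_pencil (pencil1 g))) \<and> monic_in_s D"
  have gcd_iff: "is_gcd_of D {?H} \<longleftrightarrow> D dvd ?H \<and> ?H dvd D" for D
    by (auto simp: is_gcd_of_def intro: dvd_trans)
  \<comment> \<open>Injectivity against 0 makes the homogenization nonzero, so that its leading
    coefficient can be inverted.\<close>
  have "homogenize (0 :: 'a poly) = 0" by (simp add: homogenize_def)
  hence "homogenize g \<noteq> 0"
    using assms homogenize_inject[of g 0] by auto
  hence l: "?l \<noteq> 0" by (simp only: leading_coeff_0_iff not_False_eq_True)
  have P_iff: "?P D \<longleftrightarrow> D = Polynomial.smult [:inverse ?l:] ?H" for D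
  proof -
    have "?P D \<longleftrightarrow> (\<exists>c. c \<noteq> 0 \<and> D = Polynomial.smult [:c:] ?H) \<and> monic_in_s D"
      unfolding minors_homogenize_pencil1 gcd_iff mutual_dvd_poly_poly_iff ..
    also have "\<dots> \<longleftrightarrow> (\<exists>c. c \<noteq> 0 \<and> D = Polynomial.smult [:c:] ?H \<and> c * ?l = 1)"
      by (auto simp: monic_in_s_def lead_coeff_smult)
    also have "\<dots> \<longleftrightarrow> D = Polynomial.smult [:inverse ?l:] ?H"
    proof -
      have "c * ?l = 1 \<longleftrightarrow> c = inverse ?l" for c
        using nonzero_eq_divide_eq[OF l, of c 1] unfolding inverse_eq_divide by blast
      thus ?thesis using nonzero_imp_inverse_nonzero[OF l] by metis
    qed
    finally show ?thesis .
  qed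
  have "hom_inv_factor (pencil1 g) 1 = (THE D. ?P D)"
    using assms(2) by (simp add: hom_inv_factor_def normal_rank_pencil1 det_divisor_def)
  also have "\<dots> = Polynomial.smult [:inverse ?l:] ?H"
    unfolding P_iff by simp
  finally show ?thesis using l by (intro exI[of _ "inverse ?l"]) auto
qed

text \<open>Homogenization commutes with scalars and is injective in degree at most 1, so
  proportional homogenizations come from proportional polynomials; the normalizing constants
  \<open>x\<close> and \<open>y\<close> are absorbed into the factor.\<close>

lemma hom_inv_factor_mutual_dvd_iff:
  assumes "degree g \<le> 1" "g \<noteq> 0" "degree h \<le> 1" "h \<noteq> 0"
  shows "hom_inv_factor (pencil1 g) 1 dvd hom_inv_factor (pencil1 h) 1 \<and>
      hom_inv_factor (pencil1 h) 1 dvd hom_inv_factor (pencil1 g) 1 \<longleftrightarrow>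
    (\<exists>c. c \<noteq> 0 \<and> g = Polynomial.smult c h)"
proof -
  obtain x y where x: "x \<noteq> 0" "hom_inv_factor (pencil1 g) 1 = Polynomial.smult [:x:] (homogenize g)"
    and y: "y \<noteq> 0" "hom_inv_factor (pencil1 h) 1 = Polynomial.smult [:y:] (homogenize h)"
    using hom_inv_factor_pencil1 assms by blast
  have eq: "Polynomial.smult [:x:] (homogenize g) = Polynomial.smult [:c:] (Polynomial.smult [:y:] (homogenize h))
      \<longleftrightarrow> g = Polynomial.smult (inverse x * c * y) h" for c
  proof
    assume "Polynomial.smult [:x:] (homogenize g) = Polynomial.smult [:c:] (Polynomial.smult [:y:] (homogenize h))"
    hence "homogenize (Polynomial.smult x g) = homogenize (Polynomial.smult (c * y) h)"
      by (simp add: homogenize_smult ac_simps)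
    hence "Polynomial.smult x g = Polynomial.smult (c * y) h"
      using assms by (intro homogenize_inject) (auto intro: order.trans[OF degree_smult_le])
    hence "Polynomial.smult (inverse x) (Polynomial.smult x g) = Polynomial.smult (inverse x) (Polynomial.smult (c * y) h)" by simp
    thus "g = Polynomial.smult (inverse x * c * y) h" using x(1) by (simp add: mult.assoc)
  next
    have "x * (inverse x * c * y) = c * y" using x(1) by (simp add: field_simps)
    moreover assume "g = Polynomial.smult (inverse x * c * y) h"
    ultimately have "homogenize (Polynomial.smult x g) = homogenize (Polynomial.smult (c * y) h)"
      by (metis smult_smult)
    thus "Polynomial.smult [:x:] (homogenize g) = Polynomial.smult [:c:] (Polynomial.smult [:y:] (homogenize h))"
      by (simp add: homogenize_smult ac_simps)
  qed
  show ?thesis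
    unfolding x(2) y(2) mutual_dvd_poly_poly_iff eq
  proof
    assume "\<exists>c. c \<noteq> 0 \<and> g = Polynomial.smult (inverse x * c * y) h"
    thus "\<exists>c. c \<noteq> 0 \<and> g = Polynomial.smult c h" using x(1) y(1)
      by (metis mult_eq_0_iff inverse_nonzero_iff_nonzero)
  next
    assume "\<exists>c. c \<noteq> 0 \<and> g = Polynomial.smult c h"
    then obtain c where "c \<noteq> 0" "g = Polynomial.smult c h" by blast
    \<comment> \<open>The witness solves \<open>inverse x * c' * y = c\<close> for
      \<open>c'\<close>.\<close>
    thus "\<exists>c. c \<noteq> 0 \<and> g = Polynomial.smult (inverse x * c * y) h"
      using x(1) y(1) by (intro exI[of _ "x * c * inverse y"]) (auto simp: field_simps)
  qed
qed

section \<open>Scalars in small and large fields\<close>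

text \<open>This will supply a scalar other than 0 and 1. Infinite types are listed separately
  because their \<open>CARD\<close> is 0.\<close>

lemma ex_third_element:
  assumes "infinite (UNIV :: 'a set) \<or> CARD('a) > 2"
  shows "\<exists>z::'a. z \<noteq> x \<and> z \<noteq> y"
proof (rule ccontr)
  assume "\<not> ?thesis"
  hence sub: "(UNIV :: 'a set) \<subseteq> {x, y}" by auto
  hence "finite (UNIV :: 'a set)" by (rule finite_subset) simp
  moreover have "CARD('a) \<le> card {x, y}" using sub by (intro card_mono) auto
  moreover have "card {x, y} \<le> 2" by (simp add: card_insert_if)
  ultimately show False using assms by auto
qed

lemma nonzero_eq_one_of_card_2:
  assumes "CARD('a::field) = 2" "c \<noteq> 0"
  shows "c = (1 :: 'a)"
proof (rule ccontr)
  assume "c \<noteq> 1"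
  hence "card {0, 1, c} = 3" using assms(2) by auto
  moreover have "finite (UNIV :: 'a set)" using assms(1) by (intro card_ge_0_finite) simp
  ultimately show False using assms(1) card_mono[of "UNIV :: 'a set" "{0, 1, c}"] by simp
qed


section \<open>Existence of a perturbation of prescribed rank\<close>

theorem theorem3p9:
  fixes a0 a1 b0 b1 :: "'a::field" and a b :: "'a poly" and r :: nat
    and \<phi> \<psi> :: "int \<Rightarrow> 'a poly poly"
  assumes a_def: "a = [:a0, a1:]" and b_def: "b = [:b0, b1:]"
    and a_nz: "a \<noteq> 0" and b_nz: "b \<noteq> 0"
    and phi_def: "\<phi> = hom_inv_factor (pencil1 a)"
    and psi_def: "\<psi> = hom_inv_factor (pencil1 b)"
    and r_le: "r \<le> 1"
  shows "((infinite (UNIV :: 'a set) \<or> CARD('a) > 2 \<or> r = 0) \<longrightarrow>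
      ((\<exists>p0 p1. normal_rank (pencil1 [:p0, p1:]) = r \<and>
          strictly_equivalent (pencil1 (a + [:p0, p1:])) (pencil1 b)) \<longleftrightarrow>
       (\<phi> (1 - int r) dvd \<psi> 1 \<and> \<psi> 1 dvd \<phi> (1 + int r))))
    \<and> (CARD('a) = 2 \<and> r = 1 \<longrightarrow>
      ((\<exists>p0 p1. normal_rank (pencil1 [:p0, p1:]) = 1 \<and>
          strictly_equivalent (pencil1 (a + [:p0, p1:])) (pencil1 b)) \<longleftrightarrow> a \<noteq> b))"
proof -
  have deg: "degree a \<le> 1" "degree b \<le> 1" by (simp_all add: a_def b_def)
  \<comment> \<open>The rank is a parameter because the two claims use \<open>r\<close> and the
    literal 1.\<close>
  define E where "E q \<longleftrightarrow> (\<exists>p0 p1. normal_rank (pencil1 [:p0, p1:]) = q \<and>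
    strictly_equivalent (pencil1 (a + [:p0, p1:])) (pencil1 b))" for q
  have E0: "E 0 \<longleftrightarrow> (\<exists>c. c \<noteq> 0 \<and> a = Polynomial.smult c b)"
    unfolding E_def normal_rank_pencil1 strictly_equivalent_pencil1 by auto
  have E1: "E 1 \<longleftrightarrow> (\<exists>c. c \<noteq> 0 \<and> a \<noteq> Polynomial.smult c b)"
  proof
    assume "E 1"
    then obtain p0 p1 c where "normal_rank (pencil1 [:p0, p1:]) = 1" and c: "c \<noteq> 0"
      and eq: "a + [:p0, p1:] = Polynomial.smult c b"
      unfolding E_def strictly_equivalent_pencil1 by blast
    hence "[:p0, p1:] \<noteq> 0" unfolding normal_rank_pencil1 by (metis zero_neq_one)
    hence "a \<noteq> Polynomial.smult c b" using eq by (metis add_cancel_left_right)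
    thus "\<exists>c. c \<noteq> 0 \<and> a \<noteq> Polynomial.smult c b" using c by blast
  next
    assume "\<exists>c. c \<noteq> 0 \<and> a \<noteq> Polynomial.smult c b"
    then obtain c where c: "c \<noteq> 0" "a \<noteq> Polynomial.smult c b" by blast
    \<comment> \<open>The only solution of \<open>a + p = c b\<close>; it is nonzero by the choice
      of \<open>c\<close>.\<close>
    let ?p = "[:c * b0 - a0, c * b1 - a1:]"
    have eq: "a + ?p = Polynomial.smult c b" by (simp add: a_def b_def)
    hence "?p \<noteq> 0" using c(2) by (metis add.right_neutral)
    hence "normal_rank (pencil1 ?p) = 1" unfolding normal_rank_pencil1 by (rule if_not_P)
    moreover have "strictly_equivalent (pencil1 (a + ?p)) (pencil1 b)"
      unfolding strictly_equivalent_pencil1 using c(1) eq by blast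
    ultimately show "E 1" unfolding E_def by blast
  qed
  have part1: "E r \<longleftrightarrow> \<phi> (1 - int r) dvd \<psi> 1 \<and> \<psi> 1 dvd \<phi> (1 + int r)"
    if card: "infinite (UNIV :: 'a set) \<or> CARD('a) > 2 \<or> r = 0"
  proof (cases "r = 0")
    \<comment> \<open>Both outer indices \<open>1 - r\<close> and \<open>1 + r\<close> equal 1, so
      the condition is mutual divisibility.\<close>
    case True
    thus ?thesis
      using hom_inv_factor_mutual_dvd_iff[OF deg(1) a_nz deg(2) b_nz]
      by (simp add: E0 phi_def psi_def)
  next
    case False
    hence r: "r = 1" using r_le by simp
    have "E 1"
    proof -
      obtain z :: 'a where z: "z \<noteq> 0" "z \<noteq> 1" using ex_third_element[of 0 1] card r by auto
      \<comment> \<open>Since \<open>a\<close> cannot equal both of these distinct multiples, one of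
        the factors 1 and \<open>z\<close> meets the criterion \<open>E1\<close>.\<close>
      have "Polynomial.smult 1 b \<noteq> Polynomial.smult z b"
        using z(2) b_nz by (auto simp: b_def)
      thus ?thesis unfolding E1 using z(1) by (metis zero_neq_one)
    qed
    \<comment> \<open>With these default values outside the range of indices, the divisibility
      condition becomes trivially true.\<close>
    moreover have "\<phi> 0 = 1" "\<phi> 2 = 0"
      by (auto simp: phi_def hom_inv_factor_def normal_rank_pencil1)
    ultimately show ?thesis by (simp add: r)
  qed
  \<comment> \<open>The only nonzero scalar is 1, so \<open>E1\<close> reduces to a single
    comparison.\<close>
  have part2: "E 1 \<longleftrightarrow> a \<noteq> b" if "CARD('a) = 2"
    unfolding E1 using nonzero_eq_one_of_card_2[OF that] by (metis smult_1_left zero_neq_one)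
  show ?thesis
    using part1 part2 unfolding E_def by blast
qed

end
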